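(* Let $F$ be a gauge on $\mathbb{R}^2$ that is smooth on $\mathbb{R}^2\setminus\{0\}$ and whose unit circle $S=\{x:F(x)=1\}$ is smooth and strictly convex. Let $\gamma(\tau)=(\gamma_1(\tau),\gamma_2(\tau))$ be an oriented smooth regular curve in $(\mathbb{R}^2,F)$ with arbitrary parameter $\tau$, and let $'$ denote $d/d\tau$. Then the arc-length curvature of $\gamma$ is $$k_l=\frac{\gamma_1'\gamma_2''-\gamma_1''\gamma_2'}{(F(\gamma_1',\gamma_2'))^3}\cdot F\bigl(-F_{x_2}(\gamma_1',\gamma_2'),\,F_{x_1}(\gamma_1',\gamma_2')\bigr),$$ where $F_{x_i}=\partial F/\partial x_i$.
   Context: A gauge on $\mathbb{R}^2$ is a function $F:\mathbb{R}^2\to\mathbb{R}$ with $F(x)\ge 0$, $F(x)=0\Leftrightarrow x=0$; $F(\lambda x)=\lambda F(x)$ for $\lambda>0$; $F(x+y)\le F(x)+F(y)$ (no symmetry assumed). $(x_1,x_2)$ are the standard coordinates on $\mathbb{R}^2$. Arc-length curvature: let $s$ be the arc-length parameter of $\gamma$, $ds/d\tau=F(\gamma'(\tau))$, so that $F(d\gamma/ds)=1$. Let $\varphi(t)$ be a counter-clockwise parametrization of $S$ by $F$-arc length, $F(\varphi'(t))=1$. Write $\frac{d\gamma}{ds}(s)=\varphi(\hat t(s))$ with $\hat t$ continuous. Then $k_l:=d\hat t/ds$, evaluated at the corresponding point of the curve. *)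

theory Defs
  imports "HOL-Analysis.Analysis"
begin

definition is_gauge :: "('a::real_vector \<Rightarrow> real) \<Rightarrow> bool" where
  "is_gauge F \<longleftrightarrow>
     (\<forall>x. F x \<ge> 0) \<and> (\<forall>x. F x = 0 \<longleftrightarrow> x = 0) \<and>
     (\<forall>c x. c > 0 \<longrightarrow> F (c *\<^sub>R x) = c * F x) \<and>
     (\<forall>x y. F (x + y) \<le> F x + F y)"

definition unit_circle :: "('a \<Rightarrow> real) \<Rightarrow> 'a set" where
  "unit_circle F = {x. F x = 1}"

text \<open>\<open>Ck_on k f S\<close> is meant for open \<open>S\<close> in a finite-dimensional space; there, recursion
  over all directional derivatives gives the usual class \<open>C^k\<close>.\<close>

primrec Ck_on ::
  "nat \<Rightarrow> ('a::euclidean_space \<Rightarrow> 'b::real_normed_vector) \<Rightarrow> 'a set \<Rightarrow> bool" where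
  "Ck_on 0 f S \<longleftrightarrow> continuous_on S f"
| "Ck_on (Suc k) f S \<longleftrightarrow>
     (\<forall>x\<in>S. f differentiable (at x)) \<and>
     (\<forall>v. Ck_on k (\<lambda>x. frechet_derivative f (at x) v) S)"

definition smooth_on :: "('a::euclidean_space \<Rightarrow> 'b::real_normed_vector) \<Rightarrow> 'a set \<Rightarrow> bool" where
  "smooth_on f S \<longleftrightarrow> (\<forall>k. Ck_on k f S)"

definition regular_curve :: "(real \<Rightarrow> 'a::real_normed_vector) \<Rightarrow> real set \<Rightarrow> bool" where
  "regular_curve c I \<longleftrightarrow> smooth_on c I \<and> (\<forall>t\<in>I. vector_derivative c (at t) \<noteq> 0)"

text \<open>Smoothness of a point set: it is an embedded one-dimensional submanifold, that is, every
  point has a relatively open neighbourhood with a regular smooth parametrization which is a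
  homeomorphism.\<close>

definition smooth_curve_set :: "'a::real_normed_vector set \<Rightarrow> bool" where
  "smooth_curve_set C \<longleftrightarrow>
     (\<forall>p\<in>C. \<exists>U a b c d. open U \<and> p \<in> U \<and> regular_curve c {a<..<b} \<and>
        homeomorphism {a<..<b} (C \<inter> U) c d)"

text \<open>Strict convexity of the unit circle: chords run, apart from their endpoints, inside the
  open unit disc (equivalently, the circle contains no line segment).\<close>

definition strictly_convex_circle :: "('a::real_vector \<Rightarrow> real) \<Rightarrow> bool" where
  "strictly_convex_circle F \<longleftrightarrow>
     (\<forall>x\<in>unit_circle F. \<forall>y\<in>unit_circle F. open_segment x y \<subseteq> {z. F z < 1})"

definition partial_deriv :: "(real^2 \<Rightarrow> real) \<Rightarrow> 2 \<Rightarrow> real^2 \<Rightarrow> real" where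
  "partial_deriv F i p = deriv (\<lambda>h. F (p + h *\<^sub>R axis i 1)) 0"

text \<open>Counter-clockwise: a continuous polar angle along the curve is increasing.\<close>

definition counterclockwise :: "(real \<Rightarrow> real^2) \<Rightarrow> bool" where
  "counterclockwise \<phi> \<longleftrightarrow>
     (\<exists>\<theta>. continuous_on UNIV \<theta> \<and> strict_mono \<theta> \<and>
        (\<forall>t. \<phi> t = norm (\<phi> t) *\<^sub>R vector [cos (\<theta> t), sin (\<theta> t)]))"

text \<open>The parametrization is defined on the whole line and runs around the circle repeatedly, so
  that continuous lifts \<open>t\<close> below exist also when the tangent turns more than once.\<close>

definition ccw_arclength_parametrization ::
  "(real^2 \<Rightarrow> real) \<Rightarrow> (real \<Rightarrow> real^2) \<Rightarrow> bool" where
  "ccw_arclength_parametrization F \<phi> \<longleftrightarrow>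
     range \<phi> = unit_circle F \<and> counterclockwise \<phi> \<and>
     (\<forall>t. \<phi> differentiable (at t) \<and> F (vector_derivative \<phi> (at t)) = 1)"

definition arclength_parameter ::
  "('a::real_normed_vector \<Rightarrow> real) \<Rightarrow> (real \<Rightarrow> 'a) \<Rightarrow> real set \<Rightarrow> (real \<Rightarrow> real) \<Rightarrow> bool" where
  "arclength_parameter F \<gamma> I s \<longleftrightarrow>
     (\<forall>\<tau>\<in>I. (s has_real_derivative F (vector_derivative \<gamma> (at \<tau>))) (at \<tau>))"

text \<open>\<open>t\<close> is a continuous function of the arc length \<open>\<sigma>\<close> with \<open>d\<gamma>/d\<sigma> = \<phi>(t(\<sigma>))\<close>, where \<open>\<gamma>\<close> is
  reparametrized by arc length through the inverse of \<open>s\<close>.\<close>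

definition tangent_lift ::
  "(real \<Rightarrow> real^2) \<Rightarrow> real set \<Rightarrow> (real \<Rightarrow> real^2) \<Rightarrow> (real \<Rightarrow> real) \<Rightarrow> (real \<Rightarrow> real) \<Rightarrow> bool" where
  "tangent_lift \<gamma> I \<phi> s t \<longleftrightarrow>
     continuous_on (s ` I) t \<and>
     (\<forall>\<sigma>\<in>s ` I. ((\<gamma> \<circ> the_inv_into I s) has_vector_derivative \<phi> (t \<sigma>)) (at \<sigma>))"

text \<open>The curvature \<open>dt/d\<sigma>\<close> at the point with parameter \<open>\<tau>\<close> is \<open>k\<close>: the data
  \<open>\<phi>\<close>, \<open>s\<close>, \<open>t\<close> exist, and every choice of them yields the value \<open>k\<close>.\<close>

definition has_arclength_curvature ::
  "(real^2 \<Rightarrow> real) \<Rightarrow> (real \<Rightarrow> real^2) \<Rightarrow> real set \<Rightarrow> real \<Rightarrow> real \<Rightarrow> bool" where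
  "has_arclength_curvature F \<gamma> I \<tau> k \<longleftrightarrow>
     (\<exists>\<phi> s t. ccw_arclength_parametrization F \<phi> \<and> arclength_parameter F \<gamma> I s \<and>
        tangent_lift \<gamma> I \<phi> s t) \<and>
     (\<forall>\<phi> s t. ccw_arclength_parametrization F \<phi> \<and> arclength_parameter F \<gamma> I s \<and>
        tangent_lift \<gamma> I \<phi> s t \<longrightarrow> (t has_real_derivative k) (at (s \<tau>)))"

end

theory Submission
  imports Defs
begin

text \<open>Put \<open>v = \<gamma>'(\<tau>)\<close> and \<open>N = (-F\<^sub>2(v), F\<^sub>1(v))\<close>. Since \<open>F\<close> is constant on its unit circle,
  \<open>\<phi>'\<close> is parallel to \<open>N\<close> where \<open>\<phi> = v / F(v)\<close>; the orientation and \<open>F(\<phi>') = 1\<close> give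
  \<open>\<phi>' = N / F(N)\<close>, and by Euler's identity \<open>v \<times> \<phi>' = F(v) / F(N)\<close>. Crossing
  \<open>\<phi>(t(\<sigma>)) = \<gamma>' / F(\<gamma>')\<close> with the fixed vector \<open>v\<close> and differentiating at \<open>\<tau>\<close> yields
  \<open>(v \<times> \<phi>') k = (v \<times> \<gamma>'') / F(v)\<^sup>2\<close>, because the term from the derivative of \<open>1 / F(\<gamma>')\<close> is a
  multiple of \<open>v \<times> v = 0\<close>. Existence of \<open>\<phi>\<close> follows by reparametrizing the polar form of the
  circle by arc length, and \<open>t\<close> is the arc length at a continuous polar angle of \<open>\<gamma>'\<close>.\<close>

section \<open>The planar cross product and derivatives of real functions\<close>

text \<open>The terms are ordered as in the curvature formula, so that the final statement follows
  by unfolding.\<close>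

definition cross2 :: "real^2 \<Rightarrow> real^2 \<Rightarrow> real" where
  "cross2 x y = x$1 * y$2 - y$1 * x$2"

lemma has_vector_derivative_vec2_iff:
  fixes f :: "real \<Rightarrow> real^2"
  shows "(f has_vector_derivative d) (at t) \<longleftrightarrow>
    ((\<lambda>t. f t $ 1) has_real_derivative d $ 1) (at t) \<and>
    ((\<lambda>t. f t $ 2) has_real_derivative d $ 2) (at t)"
proof -
  have "(f has_vector_derivative d) (at t) \<longleftrightarrow>
    (\<forall>i. ((\<lambda>t. f t $ i) has_vector_derivative d $ i) (at t))"
    unfolding has_vector_derivative_def
    by (subst has_derivative_componentwise_within)
       (auto simp: Basis_vec_def inner_axis)
  then show ?thesis
    by (simp add: forall_2 has_real_derivative_iff_has_vector_derivative)
qed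

text \<open>Only continuity of \<open>t\<close> is assumed: Caratheodory's difference quotient of \<open>h\<close> is continuous and
  nonzero at \<open>t \<sigma>\<close>, so it can be divided out.\<close>

lemma has_real_derivative_of_comp:
  fixes h t :: "real \<Rightarrow> real"
  assumes ht: "((\<lambda>\<sigma>. h (t \<sigma>)) has_real_derivative w) (at \<sigma>)"
    and h: "(h has_real_derivative l) (at (t \<sigma>))" and l: "l \<noteq> 0"
    and t: "isCont t \<sigma>"
  shows "(t has_real_derivative w / l) (at \<sigma>)"
proof -
  obtain p where p: "\<And>z. h (t z) - h (t \<sigma>) = p z * (z - \<sigma>)" "isCont p \<sigma>" "p \<sigma> = w"
    using ht unfolding CARAT_DERIV by blast
  obtain q where q: "\<And>z. h z - h (t \<sigma>) = q z * (z - t \<sigma>)" "isCont q (t \<sigma>)" "q (t \<sigma>) = l"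
    using h unfolding CARAT_DERIV by blast
  have qt: "isCont (\<lambda>z. q (t z)) \<sigma>"
    using isCont_o2[OF t q(2)] .
  have ne: "\<forall>\<^sub>F z in at \<sigma>. q (t z) \<noteq> 0"
    using qt q(3) l tendsto_imp_eventually_ne[of "\<lambda>z. q (t z)" l "at \<sigma>" 0]
    by (simp add: isCont_def)
  have "((\<lambda>z. p z / q (t z)) \<longlongrightarrow> w / l) (at \<sigma>)"
    using p q qt l by (intro tendsto_divide) (auto simp: isCont_def)
  moreover have "\<forall>\<^sub>F z in at \<sigma>. p z / q (t z) = (t z - t \<sigma>) / (z - \<sigma>)"
    using ne eventually_neq_at_within[of \<sigma>]
  proof eventually_elim
    case (elim z)
    have "p z * (z - \<sigma>) = q (t z) * (t z - t \<sigma>)"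
      using p(1)[of z] q(1)[of "t z"] by simp
    then show ?case using elim by (simp add: field_simps)
  qed
  ultimately show ?thesis
    unfolding has_field_derivative_iff by (rule Lim_transform_eventually)
qed

section \<open>Antiderivatives and inverse functions on the line\<close>

lemma antiderivative_on_open_interval:
  fixes f :: "real \<Rightarrow> real"
  assumes "open I" "is_interval I" "continuous_on I f"
  obtains S where "\<forall>x\<in>I. (S has_real_derivative f x) (at x)"
proof (cases "I = {}")
  case True
  with that show ?thesis by auto
next
  case False
  then obtain a where a: "a \<in> I" by auto
  define S where "S x = (if a \<le> x then integral {a..x} f else - integral {x..a} f)" for x
  have "(S has_real_derivative f x) (at x)" if x: "x \<in> I" for x
  proof -
    obtain e where e: "e > 0" "cball x e \<subseteq> I"
      using \<open>open I\<close> x open_contains_cball by blast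
    \<comment> \<open>The interval from \<open>c\<close> to \<open>d\<close> stays in
      \<open>I\<close>, contains the base point \<open>a\<close> and has \<open>x\<close> in its
      interior. On it \<open>S\<close> differs from the integral starting at \<open>c\<close> by a
      constant.\<close>
    define c where "c = min a (x - e)"
    define d where "d = max a (x + e)"
    have "c \<in> I" "d \<in> I"
      using e a by (auto simp: c_def d_def min_def max_def cball_def dist_real_def subset_iff)
    then have cd: "{c..d} \<subseteq> I"
      using \<open>is_interval I\<close> by (meson atLeastAtMost_iff is_interval_1 subsetI)
    have cont: "continuous_on {c..d} f"
      using assms(3) cd continuous_on_subset by blast
    have int: "f integrable_on {u..v}" if "c \<le> u" "v \<le> d" for u v
      using cont that by (intro integrable_continuous_real) (auto intro: continuous_on_subset)
    have S: "S y = integral {c..y} f - integral {c..a} f" if "y \<in> {c..d}" for y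
    proof (cases "a \<le> y")
      case True
      then have "integral {c..a} f + integral {a..y} f = integral {c..y} f"
        using that by (intro Henstock_Kurzweil_Integration.integral_combine int) (auto simp: c_def)
      then show ?thesis using True by (simp add: S_def)
    next
      case False
      then have "integral {c..y} f + integral {y..a} f = integral {c..a} f"
        using that by (intro Henstock_Kurzweil_Integration.integral_combine int) (auto simp: d_def)
      then show ?thesis using False by (simp add: S_def)
    qed
    have xin: "x \<in> {c<..<d}" using e by (auto simp: c_def d_def)
    have "((\<lambda>y. integral {c..y} f) has_real_derivative f x) (at x within {c..d})"
      using xin by (intro integral_has_real_derivative cont) auto
    then have "((\<lambda>y. integral {c..y} f) has_real_derivative f x) (at x)"
      using xin at_within_interior[of x "{c..d}"] by simp
    then have "((\<lambda>y. integral {c..y} f - integral {c..a} f) has_real_derivative f x) (at x)"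
      by (auto intro!: derivative_eq_intros)
    then show ?thesis
      by (rule has_field_derivative_transform_within_open[where S="{c<..<d}"]) (use xin S in auto)
  qed
  then show ?thesis using that by blast
qed

text \<open>The uniform bound \<open>m\<close> forces \<open>L\<close> to grow at least linearly in
  both directions, which makes it onto; a derivative that is merely positive would allow a bounded
  \<open>L\<close>.\<close>

lemma positive_derivative_bij:
  fixes L g :: "real \<Rightarrow> real"
  assumes L: "\<And>x. (L has_real_derivative g x) (at x)" and g: "\<And>x. m \<le> g x" and m: "0 < m"
  obtains M where "strict_mono M" "\<And>x. M (L x) = x" "\<And>y. L (M y) = y"
    "\<And>y. (M has_real_derivative inverse (g (M y))) (at y)"
proof -
  have gp: "g x > 0" for x using g[of x] m by linarith
  have mono: "strict_mono L"
    using L gp by (intro strict_monoI) (meson DERIV_pos_imp_increasing)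
  have cont: "continuous_on A L" for A
    using L by (meson DERIV_isCont continuous_at_imp_continuous_on)
  have grow: "L y - L x \<ge> m * (y - x)" if "x \<le> y" for x y
  proof (cases "x = y")
    case False
    then have "x < y" using that by simp
    from MVT2[OF this, of L g] L obtain z where "L y - L x = (y - x) * g z" by auto
    then show ?thesis using g[of z] \<open>x < y\<close> by (simp add: mult.commute mult_left_mono)
  qed auto
  have "\<exists>x. L x = y" for y
  proof -
    \<comment> \<open>Over a length \<open>b\<close>, growth at rate \<open>m\<close> covers the
      distance from \<open>L 0\<close> to \<open>y\<close>.\<close>
    define b where "b = (\<bar>y - L 0\<bar>) / m"
    have b: "0 \<le> b" "m * b = \<bar>y - L 0\<bar>" using m by (auto simp: b_def)
    have "L (-b) \<le> y" "y \<le> L b"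
      using grow[of "-b" 0] grow[of 0 b] b by auto
    then show ?thesis
      using IVT'[of L "-b" y b] b cont by auto
  qed
  then obtain M where LM: "\<And>y. L (M y) = y" by metis
  have inv: "M (L x) = x" for x
    using LM[of "L x"] mono by (simp add: strict_mono_eq)
  show ?thesis
  proof
    show "strict_mono M"
      by (metis LM mono strict_mono_less strict_monoI)
    show "M (L x) = x" "L (M y) = y" for x y using LM inv by auto
    show "(M has_real_derivative inverse (g (M y))) (at y)" for y
    proof -
      have "(M has_derivative (*) (inverse (g (M y)))) (at (L (M y)))"
      proof (rule has_derivative_inverse_strong[where S=UNIV and f=L and f'="(*) (g (M y))"])
        show "(L has_derivative (*) (g (M y))) (at (M y))"
          using L has_field_derivative_def by blast
        show "(*) (g (M y)) \<circ> (*) (inverse (g (M y))) = id"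
          using gp[of "M y"] by (auto simp: fun_eq_iff)
      qed (auto simp: inv cont)
      then show ?thesis by (simp add: LM has_field_derivative_def)
    qed
  qed
qed

text \<open>The local counterpart for arc length along a curve: the image of \<open>I\<close> may be
  a proper part of the line, so the inverse is \<open>the_inv_into I s\<close>, as in
  \<open>tangent_lift\<close>. Openness of the image makes full derivatives there
  meaningful.\<close>

lemma positive_derivative_inverse:
  fixes s g :: "real \<Rightarrow> real"
  assumes I: "open I" "is_interval I"
    and s: "\<forall>x\<in>I. (s has_real_derivative g x) (at x)"
    and g: "\<forall>x\<in>I. g x > 0"
  shows "inj_on s I" "open (s ` I)" "\<And>x. x \<in> I \<Longrightarrow> the_inv_into I s (s x) = x"
    "\<And>x. x \<in> I \<Longrightarrow> (the_inv_into I s has_real_derivative inverse (g x)) (at (s x))"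
proof -
  have less: "s x < s y" if "x \<in> I" "y \<in> I" "x < y" for x y
  proof (rule DERIV_pos_imp_increasing[OF \<open>x < y\<close>])
    fix z assume "x \<le> z" "z \<le> y"
    then have "z \<in> I" using that I by (meson is_interval_1)
    then show "\<exists>d. (s has_real_derivative d) (at z) \<and> 0 < d" using s g by blast
  qed
  show inj: "inj_on s I"
    by (rule linorder_inj_onI') (use less in force)
  have cont: "continuous_on I s"
    using s by (meson DERIV_isCont continuous_at_imp_continuous_on)
  show "open (s ` I)"
    using invariance_of_domain[OF cont I(1) inj] .
  show inv: "the_inv_into I s (s x) = x" if "x \<in> I" for x
    using the_inv_into_f_f[OF inj that] .
  show "(the_inv_into I s has_real_derivative inverse (g x)) (at (s x))" if "x \<in> I" for x
    unfolding has_field_derivative_def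
  proof (rule has_derivative_inverse_strong[OF I(1) that cont inv])
    show "(s has_derivative (*) (g x)) (at x)"
      using s that has_field_derivative_def by blast
    show "(*) (g x) \<circ> (*) (inverse (g x)) = id"
      using g that by (auto simp: fun_eq_iff)
  qed
qed

section \<open>Polar angles and orientation\<close>

text \<open>Read in the complex plane, a continuous function without zeros on an interval has a
  continuous logarithm, because the interval is contractible. Its imaginary part is the
  angle.\<close>

lemma continuous_polar_angle:
  fixes w :: "real \<Rightarrow> real^2"
  assumes "is_interval I" "continuous_on I w" "\<And>u. u \<in> I \<Longrightarrow> w u \<noteq> 0"
  obtains \<theta> where "continuous_on I \<theta>"
    "\<And>u. u \<in> I \<Longrightarrow> w u = norm (w u) *\<^sub>R vector [cos (\<theta> u), sin (\<theta> u)]"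
proof -
  define f where "f u = Complex (w u $ 1) (w u $ 2)" for u
  have f: "f = (\<lambda>u. complex_of_real (w u $ 1) + \<i> * complex_of_real (w u $ 2))"
    by (auto simp: f_def complex_eq_iff)
  have "continuous_on I f"
    unfolding f by (intro continuous_intros assms)
  moreover have "contractible I"
    using assms(1) by (simp add: is_interval_convex convex_imp_contractible)
  moreover have "f u \<noteq> 0" if "u \<in> I" for u
    using assms(3)[OF that] by (auto simp: f_def complex_eq_iff vec_eq_iff forall_2)
  ultimately obtain g where g: "continuous_on I g" "\<And>u. u \<in> I \<Longrightarrow> f u = exp (g u)"
    using continuous_logarithm_on_contractible by metis
  show ?thesis
  proof
    show "continuous_on I (\<lambda>u. Im (g u))" by (intro continuous_intros g)
    fix u assume u: "u \<in> I"
    have "norm (w u) = norm (f u)"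
      by (simp add: f_def norm_vec_def L2_set_def sum_2 cmod_def)
    also have "\<dots> = exp (Re (g u))" using g(2)[OF u] by simp
    finally have n: "norm (w u) = exp (Re (g u))" .
    have "w u $ 1 = Re (f u)" "w u $ 2 = Im (f u)" by (auto simp: f_def)
    then show "w u = norm (w u) *\<^sub>R vector [cos (Im (g u)), sin (Im (g u))]"
      using g(2)[OF u] n by (simp add: vec_eq_iff forall_2 Re_exp Im_exp)
  qed
qed

lemma cross2_scaleR_right: "cross2 x (c *\<^sub>R y) = c * cross2 x y"
  by (simp add: cross2_def algebra_simps)

lemma cross2_has_real_derivative:
  assumes "(f has_vector_derivative d) (at t)"
  shows "((\<lambda>t. cross2 x (f t)) has_real_derivative cross2 x d) (at t)"
  using assms unfolding has_vector_derivative_vec2_iff cross2_def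
  by (auto intro!: derivative_eq_intros)

text \<open>A negative value would turn \<open>\<phi>\<close> clockwise just after \<open>t\<close>,
  whereas a small increase of the angle, below \<open>pi\<close>, has positive sine. Only the weak
  inequality follows, since a strictly increasing angle may have zero speed.\<close>

lemma counterclockwise_cross2_nonneg:
  assumes "counterclockwise \<phi>" "(\<phi> has_vector_derivative d) (at t)"
  shows "0 \<le> cross2 (\<phi> t) d"
proof (rule ccontr)
  assume "\<not> 0 \<le> cross2 (\<phi> t) d"
  then obtain \<delta> where \<delta>: "\<delta> > 0"
    "\<And>h. 0 < h \<Longrightarrow> h < \<delta> \<Longrightarrow> cross2 (\<phi> t) (\<phi> (t + h)) < cross2 (\<phi> t) (\<phi> t)"
    using DERIV_neg_dec_right[OF cross2_has_real_derivative[OF assms(2)], of "\<phi> t"]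
    by (metis not_le)
  obtain \<theta> where \<theta>: "continuous_on UNIV \<theta>" "strict_mono \<theta>"
    "\<And>t. \<phi> t = norm (\<phi> t) *\<^sub>R vector [cos (\<theta> t), sin (\<theta> t)]"
    using assms(1) unfolding counterclockwise_def by blast
  have "isCont \<theta> t" using \<theta>(1) by (simp add: continuous_on_eq_continuous_at)
  then obtain e where e: "e > 0" "\<And>y. dist y t < e \<Longrightarrow> dist (\<theta> y) (\<theta> t) < pi"
    unfolding continuous_at_eps_delta using pi_gt_zero by blast
  define h where "h = min \<delta> e / 2"
  have h: "0 < h" "h < \<delta>" "h < e" using \<delta>(1) e(1) by (auto simp: h_def)
  have "\<theta> t < \<theta> (t + h)" using \<theta>(2) h(1) by (simp add: strict_mono_less)
  moreover have "\<theta> (t + h) - \<theta> t < pi" using e(2)[of "t + h"] h by (simp add: dist_real_def)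
  ultimately have "sin (\<theta> (t + h) - \<theta> t) > 0" by (intro sin_gt_zero) auto
  then have s: "norm (\<phi> t) * norm (\<phi> (t + h)) * sin (\<theta> (t + h) - \<theta> t) \<ge> 0" by simp
  \<comment> \<open>Radii and angles are arbitrary here because the polar form of
    \<open>\<phi>\<close> has \<open>\<phi>\<close> on its right side too: as a rewrite rule it
    terminates only from right to left.\<close>
  have c: "cross2 (r *\<^sub>R vector [cos a, sin a]) (r' *\<^sub>R vector [cos b, sin b]) = r * r' * sin (b - a)"
    for r r' a b by (simp add: cross2_def sin_diff algebra_simps)
  have "cross2 (\<phi> t) (\<phi> (t + h)) = norm (\<phi> t) * norm (\<phi> (t + h)) * sin (\<theta> (t + h) - \<theta> t)"
    using c[of "norm (\<phi> t)" "\<theta> t" "norm (\<phi> (t + h))" "\<theta> (t + h)"]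
    by (simp only: \<theta>(3)[symmetric])
  then show False using s \<delta>(2)[OF h(1,2)] by (simp add: cross2_def)
qed

section \<open>Differential calculus of a smooth gauge\<close>

lemma gauge_pos: "is_gauge F \<Longrightarrow> x \<noteq> 0 \<Longrightarrow> F x > 0"
  unfolding is_gauge_def by (metis order_less_le)

lemma gauge_scale: "is_gauge F \<Longrightarrow> 0 < c \<Longrightarrow> F (c *\<^sub>R x) = c * F x"
  unfolding is_gauge_def by blast

lemma smooth_on_differentiable: "smooth_on f S \<Longrightarrow> x \<in> S \<Longrightarrow> f differentiable (at x)"
  unfolding smooth_on_def by (metis Ck_on.simps(2))

lemma smooth_on_frechet_derivative:
  "smooth_on f S \<Longrightarrow> smooth_on (\<lambda>x. frechet_derivative f (at x) v) S"
  unfolding smooth_on_def by (metis Ck_on.simps(2))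

lemma smooth_on_imp_continuous_on: "smooth_on f S \<Longrightarrow> continuous_on S f"
  unfolding smooth_on_def by (metis Ck_on.simps(1))

text \<open>Partial derivatives are defined by one-variable limits, while \<open>smooth_on\<close>
  speaks of Frechet derivatives; restriction to a coordinate line connects the two.\<close>

lemma partial_deriv_eq_frechet_derivative:
  assumes "F differentiable (at x)"
  shows "partial_deriv F i x = frechet_derivative F (at x) (axis i 1)"
proof -
  have "((\<lambda>h. x + h *\<^sub>R axis i 1) has_derivative (\<lambda>h. h *\<^sub>R axis i 1)) (at 0)"
    by (auto intro!: derivative_eq_intros)
  moreover have F: "(F has_derivative frechet_derivative F (at x)) (at (x + 0 *\<^sub>R axis i 1))"
    using assms by (simp add: frechet_derivative_works)
  ultimately have "((\<lambda>h. F (x + h *\<^sub>R axis i 1)) has_derivative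
      (\<lambda>h. frechet_derivative F (at x) (h *\<^sub>R axis i 1))) (at 0)"
    by (rule has_derivative_compose)
  moreover have "(\<lambda>h. frechet_derivative F (at x) (h *\<^sub>R axis i 1)) =
      (*) (frechet_derivative F (at x) (axis i 1))"
    using linear_frechet_derivative[OF assms] by (simp add: linear_cmul fun_eq_iff)
  ultimately show ?thesis
    unfolding partial_deriv_def by (metis DERIV_imp_deriv has_field_derivative_def)
qed

locale smooth_gauge =
  fixes F :: "real^2 \<Rightarrow> real"
  assumes gauge: "is_gauge F" and smooth: "smooth_on F (- {0})"
begin

lemmas pos = gauge_pos[OF gauge] and scale = gauge_scale[OF gauge]

lemma has_derivative_F:
  assumes "x \<noteq> 0"
  shows "(F has_derivative (\<lambda>h. partial_deriv F 1 x * h $ 1 + partial_deriv F 2 x * h $ 2)) (at x)"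
proof -
  let ?D = "frechet_derivative F (at x)"
  have d: "F differentiable (at x)"
    using smooth_on_differentiable[OF smooth] assms by simp
  have "?D h = partial_deriv F 1 x * h $ 1 + partial_deriv F 2 x * h $ 2" for h
  proof -
    have h: "h = h $ 1 *\<^sub>R axis 1 1 + h $ 2 *\<^sub>R axis 2 1"
      by (simp add: vec_eq_iff forall_2 axis_def)
    have "?D h = h $ 1 * ?D (axis 1 1) + h $ 2 * ?D (axis 2 1)"
      using linear_frechet_derivative[OF d]
      by (subst h) (simp add: linear_add linear_cmul)
    then show ?thesis using d by (simp add: partial_deriv_eq_frechet_derivative)
  qed
  then show ?thesis using d frechet_derivative_works[of F "at x"] by presburger
qed

lemma continuous_on_partial_deriv: "continuous_on (- {0}) (partial_deriv F i)"
proof -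
  have "continuous_on (- {0}) (\<lambda>x. frechet_derivative F (at x) (axis i 1))"
    using smooth_on_imp_continuous_on smooth_on_frechet_derivative smooth by blast
  then show ?thesis
    by (rule continuous_on_eq)
      (simp add: partial_deriv_eq_frechet_derivative smooth_on_differentiable[OF smooth])
qed

lemma continuous_on_F: "continuous_on (- {0}) F"
  using smooth smooth_on_imp_continuous_on by blast

lemma chain_F:
  assumes "(f has_vector_derivative d) (at t)" "f t \<noteq> 0"
  shows "((\<lambda>t. F (f t)) has_real_derivative
     partial_deriv F 1 (f t) * d $ 1 + partial_deriv F 2 (f t) * d $ 2) (at t)"
  unfolding has_field_derivative_def
  by (rule has_derivative_eq_rhs[OF has_derivative_compose[OF
        assms(1)[unfolded has_vector_derivative_def] has_derivative_F[OF assms(2)]]])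
     (auto simp: algebra_simps)

text \<open>Two derivatives of \<open>F (c *\<^sub>R x)\<close> at \<open>c = 1\<close> are
  compared: one by the chain rule, one by homogeneity, which holds for the positive \<open>c\<close>
  near \<open>1\<close>.\<close>

lemma euler:
  assumes "x \<noteq> 0"
  shows "partial_deriv F 1 x * x $ 1 + partial_deriv F 2 x * x $ 2 = F x"
proof -
  have "((\<lambda>c::real. c *\<^sub>R x) has_vector_derivative x) (at 1)"
    by (auto intro!: derivative_eq_intros simp: has_vector_derivative_def)
  from chain_F[OF this] assms have "((\<lambda>c. F (c *\<^sub>R x)) has_real_derivative
     partial_deriv F 1 x * x $ 1 + partial_deriv F 2 x * x $ 2) (at 1)" by simp
  moreover have "((\<lambda>c. F (c *\<^sub>R x)) has_real_derivative F x) (at 1)"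
    by (rule has_field_derivative_transform_within_open[where S="{0<..}" and f="\<lambda>c. c * F x"])
      (auto intro!: derivative_eq_intros simp: scale)
  ultimately show ?thesis by (rule DERIV_unique)
qed


section \<open>The tangent of the unit circle\<close>

text \<open>The product form of the value of \<open>v\<close> crossed with the velocity spares a
  separate proof that the rotated gradient is nonzero.\<close>

lemma cross2_vector_derivative_parametrization:
  assumes \<phi>: "ccw_arclength_parametrization F \<phi>" and v: "v \<noteq> 0" "\<phi> t = v /\<^sub>R F v"
  shows "cross2 v (vector_derivative \<phi> (at t)) *
    F (vector [- partial_deriv F 2 v, partial_deriv F 1 v]) = F v"
proof -
  define d where "d = vector_derivative \<phi> (at t)"
  define N where "N = (vector [- partial_deriv F 2 v, partial_deriv F 1 v] :: real^2)"
  define c where "c = cross2 v d"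
  have Fv: "F v > 0" using pos v by simp
  have d: "(\<phi> has_vector_derivative d) (at t)" and Fd: "F d = 1"
    using \<phi> unfolding ccw_arclength_parametrization_def d_def
    by (auto simp: vector_derivative_works[symmetric])
  \<comment> \<open>Scaled by \<open>F v\<close>, the circle passes through \<open>v\<close> itself,
    so the gradient is taken at \<open>v\<close> and not at \<open>v /\<^sub>R F v\<close>.\<close>
  have "F (F v *\<^sub>R \<phi> u) = F v" for u
    using \<phi> Fv scale unfolding ccw_arclength_parametrization_def unit_circle_def
    by (metis (mono_tags, lifting) mem_Collect_eq mult.right_neutral rangeI)
  moreover have "((\<lambda>u. F v *\<^sub>R \<phi> u) has_vector_derivative F v *\<^sub>R d) (at t)"
    using d by (auto intro!: derivative_eq_intros)
  from chain_F[OF this] have "((\<lambda>u. F (F v *\<^sub>R \<phi> u)) has_real_derivative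
      partial_deriv F 1 v * (F v * d $ 1) + partial_deriv F 2 v * (F v * d $ 2)) (at t)"
    using v Fv by simp
  ultimately have "((\<lambda>u. F v) has_real_derivative
      F v * (partial_deriv F 1 v * d $ 1 + partial_deriv F 2 v * d $ 2)) (at t)"
    by (simp add: algebra_simps)
  then have tangent: "partial_deriv F 1 v * d $ 1 + partial_deriv F 2 v * d $ 2 = 0"
    using Fv DERIV_unique[OF _ DERIV_const] by fastforce
  \<comment> \<open>Being orthogonal to the gradient, \<open>d\<close> is a multiple of
    \<open>N\<close>. The factor is found by crossing with \<open>v\<close>, as
    \<open>cross2 v N = F v\<close> by Euler's identity.\<close>
  have Fvd: "F v *\<^sub>R d = c *\<^sub>R N"
  proof -
    have "F v * d $ 1 = - c * partial_deriv F 2 v"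
      unfolding euler[OF v(1), symmetric] c_def cross2_def using tangent by algebra
    moreover have "F v * d $ 2 = c * partial_deriv F 1 v"
      unfolding euler[OF v(1), symmetric] c_def cross2_def using tangent by algebra
    ultimately show ?thesis by (simp add: vec_eq_iff forall_2 N_def)
  qed
  \<comment> \<open>The sign of \<open>c\<close> matters: \<open>F\<close> need not be symmetric, so
    \<open>F (c *\<^sub>R N) = c * F N\<close> is available only for positive
    \<open>c\<close>.\<close>
  have "cross2 (\<phi> t) d \<ge> 0"
    using \<phi> d counterclockwise_cross2_nonneg unfolding ccw_arclength_parametrization_def by blast
  moreover have "cross2 (\<phi> t) d = c / F v"
    by (simp add: v(2) c_def cross2_def diff_divide_distrib divide_inverse algebra_simps)
  ultimately have "c \<ge> 0" using Fv by (simp add: zero_le_divide_iff)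
  moreover have "c \<noteq> 0"
  proof
    assume "c = 0"
    then have "d = 0" using Fvd Fv by simp
    then show False using Fd gauge unfolding is_gauge_def by (metis zero_neq_one)
  qed
  ultimately have "c > 0" by simp
  have "F (F v *\<^sub>R d) = F (c *\<^sub>R N)" using Fvd by simp
  then show ?thesis
    using Fv \<open>c > 0\<close> Fd by (simp add: scale c_def N_def d_def)
qed

section \<open>Existence of the arc-length parametrization of the unit circle\<close>

text \<open>\<open>L\<close> is arc length as a function of the polar angle. Composed with a
  continuous angle of a velocity, it lifts the direction of that velocity to the parameter line of
  \<open>\<phi>\<close>.\<close>

lemma ccw_arclength_parametrization_exists:
  obtains \<phi> L where "ccw_arclength_parametrization F \<phi>" "continuous_on UNIV L"
    "\<And>x \<theta>. x \<noteq> 0 \<Longrightarrow> x = norm x *\<^sub>R vector [cos \<theta>, sin \<theta>] \<Longrightarrow> \<phi> (L \<theta>) = x /\<^sub>R F x"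
proof -
  \<comment> \<open>\<open>c\<close> is the radial projection of the Euclidean circle
    \<open>e\<close> to the unit circle of \<open>F\<close>. \<open>J\<close> is the
    counter-clockwise quarter turn, and away from zero \<open>D x\<close> is the derivative of
    \<open>F\<close> at \<open>x\<close> in direction \<open>J x\<close>.\<close>
  define e where "e \<theta> = (vector [cos \<theta>, sin \<theta>] :: real^2)" for \<theta>
  define J where "J x = (vector [- x $ 2, x $ 1] :: real^2)" for x :: "real^2"
  define D where "D x = partial_deriv F 1 x * J x $ 1 + partial_deriv F 2 x * J x $ 2" for x
  define T where "T x = J x /\<^sub>R F x - (D x / (F x)^2) *\<^sub>R x" for x
  define c where "c \<theta> = e \<theta> /\<^sub>R F (e \<theta>)" for \<theta>
  \<comment> \<open>\<open>T (e \<theta>)\<close> is the velocity of \<open>c\<close>. Writing it as a function of the point makes the lower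
    bound on its length a matter of compactness of the sphere.\<close>
  have norm_e: "norm (e \<theta>) = 1" for \<theta>
    by (simp add: e_def norm_vec_def L2_set_def sum_2)
  have e0: "e \<theta> \<noteq> 0" for \<theta> using norm_e[of \<theta>] by auto
  have Fe: "F (e \<theta>) > 0" for \<theta> using pos e0 by simp
  have e': "(e has_vector_derivative J (e \<theta>)) (at \<theta>)" for \<theta>
    unfolding has_vector_derivative_vec2_iff e_def J_def by (auto intro!: derivative_eq_intros)
  have Fe': "((\<lambda>\<theta>. F (e \<theta>)) has_real_derivative D (e \<theta>)) (at \<theta>)" for \<theta>
    using chain_F[OF e' e0] unfolding D_def .
  have c': "(c has_vector_derivative T (e \<theta>)) (at \<theta>)" for \<theta>
  proof -
    have "((\<lambda>\<theta>. inverse (F (e \<theta>))) has_real_derivative - D (e \<theta>) / (F (e \<theta>))^2) (at \<theta>)"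
      using Fe[of \<theta>] Fe' by (auto intro!: derivative_eq_intros simp: power2_eq_square field_simps)
    from has_vector_derivative_scaleR[OF this e'] show ?thesis
      unfolding c_def[abs_def] T_def by simp
  qed
  have Jcont: "continuous_on A J" for A :: "(real^2) set"
  proof -
    have "continuous_on A (\<lambda>x. if i = 1 then - x $ 2 else x $ 1)" for i :: 2
      by (cases "i = 1") (auto intro!: continuous_intros)
    then have "continuous_on A (\<lambda>x. \<chi> i::2. if i = 1 then - x $ 2 else x $ 1)"
      by (rule continuous_on_vec_lambda)
    then show ?thesis
      by (rule continuous_on_eq) (simp add: J_def vec_eq_iff forall_2)
  qed
  have Tcont: "continuous_on (- {0}) T"
    unfolding T_def D_def using pos
    by (intro continuous_intros continuous_on_F continuous_on_partial_deriv Jcont)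
      (force dest: pos)+
  \<comment> \<open>Crossing with \<open>x\<close> removes the radial term of
    \<open>T x\<close>.\<close>
  have T0: "T x \<noteq> 0" if "x \<noteq> 0" for x
  proof
    assume "T x = 0"
    then have "cross2 x (T x) = 0" by (simp add: cross2_def)
    moreover have "cross2 x (T x) = ((x $ 1)^2 + (x $ 2)^2) / F x"
      using pos[OF that]
      by (simp add: cross2_def T_def J_def power2_eq_square field_simps)
    moreover have "(x $ 1)^2 + (x $ 2)^2 > 0"
      using that by (auto simp: vec_eq_iff forall_2 sum_power2_gt_zero_iff)
    ultimately show False using pos[OF that] by simp
  qed
  have FTcont: "continuous_on (- {0}) (\<lambda>x. F (T x))"
    by (rule continuous_on_compose2[OF continuous_on_F Tcont]) (rule image_subsetI, simp add: T0)
  obtain m where m: "m > 0" "\<And>\<theta>. m \<le> F (T (e \<theta>))"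
  proof -
    have "continuous_on (sphere 0 1) (\<lambda>x::real^2. F (T x))"
      by (rule continuous_on_subset[OF FTcont]) auto
    moreover have "sphere (0::real^2) 1 \<noteq> {}" using norm_e[of 0] by (auto simp: sphere_def)
    ultimately obtain x where x: "x \<in> sphere 0 1" "\<And>y. y \<in> sphere 0 1 \<Longrightarrow> F (T x) \<le> F (T y)"
      using continuous_attains_inf[OF compact_sphere] by metis
    then have "x \<noteq> 0" by auto
    then have "F (T x) > 0" using pos T0 by simp
    moreover have "F (T x) \<le> F (T (e \<theta>))" for \<theta> using x(2) norm_e by simp
    ultimately show ?thesis by (rule that)
  qed
  have econt: "continuous_on UNIV e"
    using e' by (meson has_vector_derivative_continuous continuous_at_imp_continuous_on)
  have "continuous_on UNIV (\<lambda>\<theta>. F (T (e \<theta>)))"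
    by (rule continuous_on_compose2[OF FTcont econt]) (rule image_subsetI, simp add: e0)
  then obtain L where L: "\<And>\<theta>. (L has_real_derivative F (T (e \<theta>))) (at \<theta>)"
    using antiderivative_on_open_interval[of UNIV "\<lambda>\<theta>. F (T (e \<theta>))"] by auto
  obtain M where M: "strict_mono M" "\<And>x. M (L x) = x" "\<And>y. L (M y) = y"
    "\<And>y. (M has_real_derivative inverse (F (T (e (M y))))) (at y)"
    using positive_derivative_bij[OF L m(2,1)] by blast
  define \<phi> where "\<phi> = c \<circ> M"
  have \<phi>': "(\<phi> has_vector_derivative inverse (F (T (e (M y)))) *\<^sub>R T (e (M y))) (at y)" for y
    unfolding \<phi>_def
    by (intro vector_diff_chain_at c' M(4)[unfolded has_real_derivative_iff_has_vector_derivative])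
  have Fc: "F (c \<theta>) = 1" for \<theta>
    unfolding c_def using Fe[of \<theta>] by (simp add: scale)
  have polar: "\<phi> (L \<theta>) = x /\<^sub>R F x"
    if "x \<noteq> 0" "x = norm x *\<^sub>R vector [cos \<theta>, sin \<theta>]" for x \<theta>
  proof -
    have "x = norm x *\<^sub>R e \<theta>" using that(2) unfolding e_def .
    moreover have "F (norm x *\<^sub>R e \<theta>) = norm x * F (e \<theta>)" using that(1) by (intro scale) auto
    ultimately have "x /\<^sub>R F x = (norm x *\<^sub>R e \<theta>) /\<^sub>R (norm x * F (e \<theta>))" by metis
    then show ?thesis using that(1) by (simp add: \<phi>_def M(2) c_def)
  qed
  have "ccw_arclength_parametrization F \<phi>"
    unfolding ccw_arclength_parametrization_def
  proof (intro conjI allI)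
    show "range \<phi> = unit_circle F"
    proof
      show "range \<phi> \<subseteq> unit_circle F" by (auto simp: \<phi>_def unit_circle_def Fc)
      show "unit_circle F \<subseteq> range \<phi>"
      proof
        fix x assume x: "x \<in> unit_circle F"
        then have "x \<noteq> 0" using gauge unfolding unit_circle_def is_gauge_def
          by (metis (mono_tags, lifting) mem_Collect_eq zero_neq_one)
        \<comment> \<open>An angle of a single point comes from the constant curve.\<close>
        moreover obtain \<theta> where "x = norm x *\<^sub>R vector [cos \<theta>, sin \<theta>]"
          using continuous_polar_angle[of UNIV "\<lambda>_. x"] \<open>x \<noteq> 0\<close> by auto
        ultimately have "\<phi> (L \<theta>) = x" using polar x by (simp add: unit_circle_def)
        then show "x \<in> range \<phi>" by blast
      qed
    qed
    show "counterclockwise \<phi>"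
      unfolding counterclockwise_def
    proof (intro exI conjI allI)
      \<comment> \<open>Radial projection keeps polar angles, so \<open>M\<close> is an angle of
        \<open>\<phi>\<close>.\<close>
      show "continuous_on UNIV M"
        using M(4) by (meson DERIV_isCont continuous_at_imp_continuous_on)
      show "strict_mono M" by fact
      show "\<phi> t = norm (\<phi> t) *\<^sub>R vector [cos (M t), sin (M t)]" for t
        using norm_e[of "M t"] Fe[of "M t"] by (simp add: \<phi>_def c_def e_def)
    qed
    fix t
    show "\<phi> differentiable at t" using \<phi>' by (rule differentiableI_vector)
    have "F (T (e (M t))) > 0" using pos T0 e0 by simp
    then show "F (vector_derivative \<phi> (at t)) = 1"
      using \<phi>'[of t] by (simp add: vector_derivative_at scale)
  qed
  moreover have "continuous_on UNIV L"
    using L by (meson DERIV_isCont continuous_at_imp_continuous_on)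
  ultimately show ?thesis using polar by (rule that)
qed

section \<open>The curvature formula\<close>

lemma has_arclength_curvature:
  assumes I: "open I" "is_interval I" and \<gamma>: "regular_curve \<gamma> I" and \<tau>: "\<tau> \<in> I"
    and v: "v = vector_derivative \<gamma> (at \<tau>)"
    and a: "a = vector_derivative (\<lambda>u. vector_derivative \<gamma> (at u)) (at \<tau>)"
  shows "has_arclength_curvature F \<gamma> I \<tau> (cross2 v a / (F v)^3 *
    F (vector [- partial_deriv F 2 v, partial_deriv F 1 v]))"
proof -
  define g where "g u = vector_derivative \<gamma> (at u)" for u
  define N where "N = (vector [- partial_deriv F 2 v, partial_deriv F 1 v] :: real^2)"
  have smooth: "smooth_on \<gamma> I" and g0: "\<And>u. u \<in> I \<Longrightarrow> g u \<noteq> 0"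
    using \<gamma> unfolding regular_curve_def g_def by auto
  have g: "(\<gamma> has_vector_derivative g u) (at u)" if "u \<in> I" for u
    unfolding g_def using smooth_on_differentiable[OF smooth that]
    by (simp add: vector_derivative_works[symmetric])
  \<comment> \<open>Smoothness is inherited by the Frechet derivative applied to \<open>1\<close>.
    It agrees with \<open>g\<close> on \<open>I\<close>, which transfers continuity and,
    \<open>I\<close> being open, also differentiability.\<close>
  have frechet: "frechet_derivative \<gamma> (at u) 1 = g u" if "u \<in> I" for u
    unfolding g_def
    using frechet_derivative_eq_vector_derivative[OF smooth_on_differentiable[OF smooth that]]
    by simp
  have smooth': "smooth_on (\<lambda>u. frechet_derivative \<gamma> (at u) 1) I"
    by (rule smooth_on_frechet_derivative[OF smooth])
  have gcont: "continuous_on I g"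
    by (rule continuous_on_eq[OF smooth_on_imp_continuous_on[OF smooth'] frechet])
  have g': "(g has_vector_derivative a) (at \<tau>)"
  proof -
    obtain a' where "((\<lambda>u. frechet_derivative \<gamma> (at u) 1) has_vector_derivative a') (at \<tau>)"
      using smooth_on_differentiable[OF smooth' \<tau>] vector_derivative_works by blast
    then have "(g has_vector_derivative a') (at \<tau>)"
      by (rule has_vector_derivative_transform_within_open[OF _ I(1) \<tau> frechet])
    then show ?thesis by (simp add: a g_def[abs_def] vector_derivative_at)
  qed
  have Fg: "\<forall>u\<in>I. F (g u) > 0" using pos g0 by simp
  have Fgcont: "continuous_on I (\<lambda>u. F (g u))"
    by (rule continuous_on_compose2[OF continuous_on_F gcont]) (rule image_subsetI, simp add: g0)
  have arclength: "arclength_parameter F \<gamma> I s \<longleftrightarrow>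
      (\<forall>u\<in>I. (s has_real_derivative F (g u)) (at u))" for s
    by (simp add: arclength_parameter_def g_def)
  \<comment> \<open>Every arc-length parameter \<open>s\<close> is covered, since both the existence
    of a lift and its derivative rest on this.\<close>
  have unit_tangent: "((\<gamma> \<circ> the_inv_into I s) has_vector_derivative g u /\<^sub>R F (g u)) (at (s u))"
    if "arclength_parameter F \<gamma> I s" "u \<in> I" for s u
  proof -
    have s: "\<forall>u\<in>I. (s has_real_derivative F (g u)) (at u)"
      using that(1) arclength by blast
    note inv = positive_derivative_inverse[OF I s Fg]
    show ?thesis
      using that(2) g inv(3)
      by (intro vector_diff_chain_at
          inv(4)[unfolded has_real_derivative_iff_has_vector_derivative]) auto
  qed
  have "\<exists>\<phi> s t. ccw_arclength_parametrization F \<phi> \<and> arclength_parameter F \<gamma> I s \<and>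
      tangent_lift \<gamma> I \<phi> s t"
  proof -
    obtain \<phi> L where \<phi>: "ccw_arclength_parametrization F \<phi>" "continuous_on UNIV L"
      "\<And>x \<theta>. x \<noteq> 0 \<Longrightarrow> x = norm x *\<^sub>R vector [cos \<theta>, sin \<theta>] \<Longrightarrow> \<phi> (L \<theta>) = x /\<^sub>R F x"
      using ccw_arclength_parametrization_exists by blast
    obtain s where s: "\<forall>u\<in>I. (s has_real_derivative F (g u)) (at u)"
      by (rule antiderivative_on_open_interval[OF I Fgcont])
    then have arc: "arclength_parameter F \<gamma> I s" using arclength by blast
    note inv = positive_derivative_inverse[OF I s Fg]
    obtain \<theta> where \<theta>: "continuous_on I \<theta>"
      "\<And>u. u \<in> I \<Longrightarrow> g u = norm (g u) *\<^sub>R vector [cos (\<theta> u), sin (\<theta> u)]"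
      using continuous_polar_angle[OF I(2) gcont g0] by blast
    \<comment> \<open>From arc length on the curve to the curve parameter, to the angle of the
      velocity, to arc length on the circle.\<close>
    define t where "t \<sigma> = L (\<theta> (the_inv_into I s \<sigma>))" for \<sigma>
    have invcont: "continuous_on (s ` I) (the_inv_into I s)"
      using inv(4) by (auto intro!: continuous_at_imp_continuous_on intro: DERIV_isCont)
    have "continuous_on (s ` I) (\<lambda>\<sigma>. \<theta> (the_inv_into I s \<sigma>))"
      by (rule continuous_on_compose2[OF \<theta>(1) invcont]) (use inv(3) in auto)
    then have "continuous_on (s ` I) t"
      unfolding t_def by (rule continuous_on_compose2[OF \<phi>(2)]) auto
    moreover have "\<phi> (t (s u)) = g u /\<^sub>R F (g u)" if "u \<in> I" for u
      unfolding t_def inv(3)[OF that] by (rule \<phi>(3)[OF g0[OF that] \<theta>(2)[OF that]])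
    ultimately have "tangent_lift \<gamma> I \<phi> s t"
      using unit_tangent[OF arc] unfolding tangent_lift_def by auto
    with \<phi>(1) arc show ?thesis by blast
  qed
  moreover have "(t has_real_derivative cross2 v a / (F v)^3 * F N) (at (s \<tau>))"
    if \<phi>: "ccw_arclength_parametrization F \<phi>" and arc: "arclength_parameter F \<gamma> I s"
      and lift: "tangent_lift \<gamma> I \<phi> s t" for \<phi> s t
  proof -
    have s: "\<forall>u\<in>I. (s has_real_derivative F (g u)) (at u)"
      using arc arclength by blast
    note inv = positive_derivative_inverse[OF I s Fg]
    have v': "g \<tau> = v" by (simp add: g_def v)
    have Fv: "F v > 0" using Fg \<tau> v' by blast
    have v0: "v \<noteq> 0" using g0[OF \<tau>] v' by simp
    \<comment> \<open>Both sides are derivatives of the same reparametrized curve.\<close>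
    have \<phi>t: "\<phi> (t (s u)) = g u /\<^sub>R F (g u)" if "u \<in> I" for u
      using lift unit_tangent[OF arc that] that unfolding tangent_lift_def
      by (blast intro: vector_derivative_unique_at)
    have "isCont t (s \<tau>)"
      using lift inv(2) \<tau> unfolding tangent_lift_def
      by (simp add: continuous_on_eq_continuous_at)
    moreover define d where "d = vector_derivative \<phi> (at (t (s \<tau>)))"
    have "(\<phi> has_vector_derivative d) (at (t (s \<tau>)))"
      using \<phi> unfolding ccw_arclength_parametrization_def d_def
      by (simp add: vector_derivative_works[symmetric])
    then have "((\<lambda>x. cross2 v (\<phi> x)) has_real_derivative cross2 v d) (at (t (s \<tau>)))"
      by (rule cross2_has_real_derivative)
    moreover have d: "cross2 v d * F N = F v"
      unfolding d_def N_def
      by (rule cross2_vector_derivative_parametrization[OF \<phi> v0]) (use \<phi>t[OF \<tau>] v' in simp)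
    then have d0: "cross2 v d \<noteq> 0" using Fv by auto
    moreover have "((\<lambda>\<sigma>. cross2 v (\<phi> (t \<sigma>))) has_real_derivative cross2 v a / (F v)^2) (at (s \<tau>))"
    proof -
      have "((\<lambda>u. F (g u)) has_real_derivative
          partial_deriv F 1 v * a $ 1 + partial_deriv F 2 v * a $ 2) (at \<tau>)"
        using chain_F[OF g'] g0[OF \<tau>] v' by simp
      \<comment> \<open>The numerator vanishes at \<open>\<tau>\<close> because
        \<open>g \<tau> = v\<close>, so the derivative of the denominator drops out.\<close>
      from DERIV_divide[OF cross2_has_real_derivative[OF g', of v] this]
      have "((\<lambda>u. cross2 v (g u) / F (g u)) has_real_derivative cross2 v a / F v) (at \<tau>)"
        using Fv v' by (simp add: cross2_def[of v v])
      then have "((\<lambda>u. cross2 v (g u) / F (g u)) has_real_derivative cross2 v a / F v)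
          (at (the_inv_into I s (s \<tau>)))"
        by (simp add: inv(3)[OF \<tau>])
      \<comment> \<open>Passing to arc length divides by \<open>F v\<close> once more.\<close>
      from DERIV_chain2[OF this inv(4)[OF \<tau>]]
      have "((\<lambda>\<sigma>. cross2 v (g (the_inv_into I s \<sigma>)) / F (g (the_inv_into I s \<sigma>)))
          has_real_derivative cross2 v a / (F v)^2) (at (s \<tau>))"
        by (simp add: v' power2_eq_square field_simps)
      then show ?thesis
        by (rule has_field_derivative_transform_within_open[OF _ inv(2)])
          (use \<tau> inv(3) \<phi>t in \<open>auto simp: cross2_scaleR_right divide_inverse\<close>)
    qed
    ultimately have "(t has_real_derivative cross2 v a / (F v)^2 / cross2 v d) (at (s \<tau>))"
      using has_real_derivative_of_comp[of "\<lambda>x. cross2 v (\<phi> x)" t] by blast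
    \<comment> \<open>By \<open>d\<close>, dividing by \<open>cross2 v d\<close> multiplies by
      \<open>F N / F v\<close>, whence the third power.\<close>
    moreover have "cross2 v a / (F v)^2 / cross2 v d = cross2 v a / (F v)^3 * F N"
      using d0 Fv d by (simp add: field_simps power2_eq_square power3_eq_cube)
    ultimately show ?thesis by simp
  qed
  ultimately show ?thesis
    unfolding has_arclength_curvature_def N_def by blast
qed

end

theorem corollary3p1:
  fixes F :: "real^2 \<Rightarrow> real" and \<gamma> :: "real \<Rightarrow> real^2" and I :: "real set" and \<tau> :: real
  assumes "is_gauge F"
    and "smooth_on F (- {0})"
    and "smooth_curve_set (unit_circle F)"
    and "strictly_convex_circle F"
    and "open I" and "is_interval I"
    and "regular_curve \<gamma> I"
    and "\<tau> \<in> I"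
  shows "let \<gamma>' = (\<lambda>u. vector_derivative \<gamma> (at u));
             \<gamma>'' = (\<lambda>u. vector_derivative \<gamma>' (at u));
             v = \<gamma>' \<tau>;
             a = \<gamma>'' \<tau>
         in has_arclength_curvature F \<gamma> I \<tau>
              ((v$1 * a$2 - a$1 * v$2) / (F v)^3 *
               F (vector [- partial_deriv F 2 v, partial_deriv F 1 v]))"
proof -
  interpret smooth_gauge F
    using assms(1,2) by unfold_locales
  show ?thesis
    unfolding Let_def
    using has_arclength_curvature[OF assms(5-8) refl refl] unfolding cross2_def .
qed

end
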